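(* If $G$ is one of the following graphs, then $mvd(G)=1$: (i) a wheel graph $W_n=C_{n-1}\vee K_1$ other than $W_4$ (i.e. $n\geq 5$); (ii) a complete $k$-partite graph $G=K_{n_1,\ldots,n_k}$ with $k>2$ and $n_k\geq 2$, $n_{k-1}\geq 2$.
   Context: $G\vee H$ denotes the join of vertex-disjoint graphs $G,H$ (add all edges between $V(G)$ and $V(H)$); $C_{n-1}$ is the cycle on $n-1$ vertices. $K_{n_1,\ldots,n_k}$ is the complete $k$-partite graph with parts of sizes $n_1,\ldots,n_k$. For a vertex-colored graph and two nonadjacent vertices $x,y$, an $x$-$y$ vertex cut is a set $S\subseteq V(G)\setminus\{x,y\}$ such that $x$ and $y$ lie in different components of $G-S$; it is monochromatic if all its vertices have the same color. A vertex-coloring is an MVD-coloring if every pair of nonadjacent vertices has a monochromatic vertex cut separating them. $mvd(G)$ is the maximum number of colors used by an MVD-coloring of $G$. *)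

theory Defs
  imports "Graph_Theory.Graph_Theory"
begin

text \<open>
  Undirected simple graphs are represented as symmetric loop-free pair digraphs: an edge
  between \<open>u\<close> and \<open>v\<close> is the pair of arcs \<open>(u, v)\<close>, \<open>(v, u)\<close>. In such a graph the strongly
  connected components are the connected components.
\<close>

definition cycle_graph :: "nat \<Rightarrow> 'a pair_pre_digraph \<Rightarrow> bool" where
  "cycle_graph m C \<longleftrightarrow> m \<ge> 3 \<and>
     (\<exists>f. bij_betw f {..<m} (pverts C) \<and>
          parcs C = {(f i, f j) | i j. i < m \<and> j < m \<and> (j = Suc i mod m \<or> i = Suc j mod m)})"

definition graph_join :: "'a pair_pre_digraph \<Rightarrow> 'a pair_pre_digraph \<Rightarrow> 'a pair_pre_digraph" where
  "graph_join G H =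
     \<lparr> pverts = pverts G \<union> pverts H,
       parcs = parcs G \<union> parcs H \<union> pverts G \<times> pverts H \<union> pverts H \<times> pverts G \<rparr>"

definition wheel_graph :: "nat \<Rightarrow> 'a pair_pre_digraph \<Rightarrow> bool" where
  "wheel_graph n G \<longleftrightarrow>
     (\<exists>C H. cycle_graph (n - 1) C \<and> complete_digraph 1 (with_proj H) \<and>
            pverts C \<inter> pverts H = {} \<and> G = graph_join C H)"

text \<open>
  The part sizes are \<open>ns 1, \<dots>, ns k\<close>; parts are nonempty.
\<close>

definition complete_multipartite_graph ::
  "nat \<Rightarrow> (nat \<Rightarrow> nat) \<Rightarrow> 'a pair_pre_digraph \<Rightarrow> bool" where
  "complete_multipartite_graph k ns G \<longleftrightarrow>
     (\<exists>P :: nat \<Rightarrow> 'a set.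
        (\<forall>i\<in>{1..k}. finite (P i) \<and> card (P i) = ns i \<and> ns i \<ge> 1) \<and>
        (\<forall>i\<in>{1..k}. \<forall>j\<in>{1..k}. i \<noteq> j \<longrightarrow> P i \<inter> P j = {}) \<and>
        pverts G = (\<Union>i\<in>{1..k}. P i) \<and>
        parcs G = (\<Union>i\<in>{1..k}. \<Union>j\<in>{1..k} - {i}. P i \<times> P j))"

definition vertex_cut :: "'a pair_pre_digraph \<Rightarrow> 'a \<Rightarrow> 'a \<Rightarrow> 'a set \<Rightarrow> bool" where
  "vertex_cut G x y S \<longleftrightarrow> S \<subseteq> pverts G - {x, y} \<and>
     (\<exists>C \<in> pre_digraph.sccs (with_proj G \<restriction> (pverts G - S)).
      \<exists>D \<in> pre_digraph.sccs (with_proj G \<restriction> (pverts G - S)).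
        x \<in> verts C \<and> y \<in> verts D \<and> C \<noteq> D)"

definition monochromatic :: "('a \<Rightarrow> nat) \<Rightarrow> 'a set \<Rightarrow> bool" where
  "monochromatic c S \<longleftrightarrow> (\<forall>u\<in>S. \<forall>v\<in>S. c u = c v)"

definition MVD_coloring :: "'a pair_pre_digraph \<Rightarrow> ('a \<Rightarrow> nat) \<Rightarrow> bool" where
  "MVD_coloring G c \<longleftrightarrow>
     (\<forall>x\<in>pverts G. \<forall>y\<in>pverts G. x \<noteq> y \<and> (x, y) \<notin> parcs G \<longrightarrow>
        (\<exists>S. vertex_cut G x y S \<and> monochromatic c S))"

definition mvd :: "'a pair_pre_digraph \<Rightarrow> nat" where
  "mvd G = Max {card (c ` pverts G) | c. MVD_coloring G c}"

lemma cycle_graph_pair_graph: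
  assumes "cycle_graph m C" shows "pair_graph C"
proof -
  obtain f where m: "m \<ge> 3" and f: "bij_betw f {..<m} (pverts C)"
    and E: "parcs C = {(f i, f j) | i j. i < m \<and> j < m \<and> (j = Suc i mod m \<or> i = Suc j mod m)}"
    using assms unfolding cycle_graph_def by blast
  have V: "finite (pverts C)" using f bij_betw_finite by blast
  have sub: "parcs C \<subseteq> pverts C \<times> pverts C"
    using f unfolding E bij_betw_def by auto
  have "finite (parcs C)" using sub V by (meson finite_SigmaI finite_subset)
  moreover have "u \<noteq> v" if "(u, v) \<in> parcs C" for u v
  proof -
    have suc: "Suc i mod m \<noteq> i" if "i < m" for i
      using m that by (cases "Suc i = m") auto
    from that obtain i j where ij: "u = f i" "v = f j" "i < m" "j < m"
      "j = Suc i mod m \<or> i = Suc j mod m"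
      unfolding E by blast
    then have "i \<noteq> j" using suc by metis
    then show ?thesis using f ij by (auto simp: bij_betw_def dest: inj_onD)
  qed
  moreover have "symmetric C"
    unfolding symmetric_def by (rule symI) (auto simp: E)
  ultimately show ?thesis using V sub by unfold_locales auto
qed

lemma wheel_graph_pair_graph:
  assumes "wheel_graph n G" shows "pair_graph G"
proof -
  obtain C H where C: "cycle_graph (n - 1) C" and H: "complete_digraph 1 (with_proj H)"
    and disj: "pverts C \<inter> pverts H = {}" and G: "G = graph_join C H"
    using assms unfolding wheel_graph_def by blast
  interpret C: pair_graph C using C by (rule cycle_graph_pair_graph)
  from H have H': "finite (pverts H)"
    "parcs H = {(u,v). (u,v) \<in> pverts H \<times> pverts H \<and> u \<noteq> v}"
    by (simp_all add: complete_digraph_pair_def)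
  then have fin: "finite (parcs H)"
    by (auto intro: finite_subset[of _ "pverts H \<times> pverts H"])
  have "sym (parcs C)" using C.pair_sym_arcs unfolding symmetric_def by simp
  then have "symmetric G"
    unfolding symmetric_def by (intro symI) (auto simp: G graph_join_def H' dest: symD)
  moreover have "finite (pverts G)" "finite (parcs G)"
    using C.pair_finite_verts C.pair_finite_arcs H'(1) fin by (simp_all add: G graph_join_def)
  moreover have "u \<in> pverts G" "v \<in> pverts G" "u \<noteq> v" if "(u, v) \<in> parcs G" for u v
    using that disj C.wellformed'[of u v] C.pair_no_loops[of "(u, v)"]
    by (auto simp: G graph_join_def H'(2))
  ultimately show ?thesis by unfold_locales auto
qed

lemma complete_multipartite_graph_pair_graph:
  assumes "complete_multipartite_graph k ns G" shows "pair_graph G"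
proof -
  obtain P :: "nat \<Rightarrow> 'a set" where
    P: "\<forall>i\<in>{1..k}. finite (P i) \<and> card (P i) = ns i \<and> ns i \<ge> 1"
      "\<forall>i\<in>{1..k}. \<forall>j\<in>{1..k}. i \<noteq> j \<longrightarrow> P i \<inter> P j = {}"
    and V: "pverts G = (\<Union>i\<in>{1..k}. P i)"
    and E: "parcs G = (\<Union>i\<in>{1..k}. \<Union>j\<in>{1..k} - {i}. P i \<times> P j)"
    using assms unfolding complete_multipartite_graph_def by (elim exE conjE) (rule that; assumption)
  have "finite (pverts G)" "finite (parcs G)" using P(1) by (auto simp: V E)
  moreover have "symmetric G" unfolding symmetric_def by (rule symI) (auto simp: E)
  moreover have "u \<noteq> v" if "(u, v) \<in> parcs G" for u v
  proof -
    from that obtain i j where "i \<in> {1..k}" "j \<in> {1..k}" "i \<noteq> j" "u \<in> P i" "v \<in> P j"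
      unfolding E by blast
    then show ?thesis using P(2) by blast
  qed
  moreover have "parcs G \<subseteq> pverts G \<times> pverts G" by (auto simp: V E)
  ultimately show ?thesis by unfold_locales auto
qed

end

theory Submission
  imports Defs
begin

text \<open>
  A vertex cut separating \<open>x\<close> and \<open>y\<close> contains every common neighbour of \<open>x\<close> and \<open>y\<close>, so in an
  MVD-coloring the common neighbours of two nonadjacent vertices have the same color. It therefore
  suffices to find a vertex \<open>h\<close> such that every other vertex \<open>v\<close> shares with \<open>h\<close> two nonadjacent
  neighbours. In a wheel, \<open>h\<close> is the hub, and the two rim neighbours of \<open>v\<close> are nonadjacent since
  the rim has at least four vertices. In a complete multipartite graph, \<open>h\<close> is taken in the first
  part, and the two nonadjacent vertices are taken in whichever of the last two parts does not
  contain \<open>v\<close>.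
\<close>

text \<open>Trades components for reachability, which is easier to refute or to build. Arcs of the
  induced subgraph are symmetric, so a vertex reached from \<open>x\<close> also reaches
  \<open>x\<close> and shares its strong component; every vertex outside \<open>S\<close> lies in
  some component.\<close>

lemma vertex_cut_iff_not_reachable:
  assumes "pair_graph G"
  shows "vertex_cut G x y S \<longleftrightarrow>
    S \<subseteq> pverts G - {x, y} \<and> x \<in> pverts G \<and> y \<in> pverts G \<and>
    \<not> x \<rightarrow>\<^sup>*\<^bsub>with_proj G \<restriction> (pverts G - S)\<^esub> y"
proof -
  interpret pair_graph G by fact
  let ?H = "with_proj G \<restriction> (pverts G - S)"
  interpret H: sym_digraph ?H
    by (rule induced_graph_imp_graph[OF induced_induce]) simp
  have reach: "x \<rightarrow>\<^sup>*\<^bsub>?H\<^esub> y \<longleftrightarrow> C = D"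
    if "C \<in> H.sccs" "D \<in> H.sccs" "x \<in> verts C" "y \<in> verts D" for C D
  proof
    have C: "verts C \<in> H.sccs_verts" and D: "verts D \<in> H.sccs_verts"
      using that by (auto simp: H.sccs_verts_conv)
    show "x \<rightarrow>\<^sup>*\<^bsub>?H\<^esub> y" if "C = D"
      using C \<open>x \<in> verts C\<close> \<open>y \<in> verts D\<close> that
      by (auto simp: H.in_sccs_verts_conv_reachable)
    assume xy: "x \<rightarrow>\<^sup>*\<^bsub>?H\<^esub> y"
    \<comment> \<open>Mutual reachability puts \<open>y\<close> into \<open>C\<close>, and two
      components sharing a vertex coincide.\<close>
    then have "y \<rightarrow>\<^sup>*\<^bsub>?H\<^esub> x" by (rule symmetric_reachable[OF H.sym_arcs])
    with xy C \<open>x \<in> verts C\<close> have "y \<in> verts C"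
      unfolding H.in_sccs_verts_conv_reachable by blast
    with that show "C = D" using H.scc_disj by blast
  qed
  have scc: "\<exists>C\<in>H.sccs. v \<in> verts C" if "v \<in> pverts G - S" for v
  proof -
    have "H.scc_of v \<in> verts ` H.sccs" "v \<in> H.scc_of v"
      using H.scc_of_in_sccs_verts[of v] H.in_scc_of_self[of v] that
      by (simp_all add: H.sccs_verts_conv)
    then show ?thesis by auto
  qed
  have sub: "verts C \<subseteq> pverts G - S" if "C \<in> H.sccs" for C
    using H.sccs_verts_subsets[of "verts C"] that by (simp add: H.sccs_verts_conv)
  show ?thesis (is "_ \<longleftrightarrow> ?R")
  proof
    assume "vertex_cut G x y S"
    then show ?R unfolding vertex_cut_def using reach sub by blast
  next
    assume R: ?R
    then obtain C D where "C \<in> H.sccs" "D \<in> H.sccs" "x \<in> verts C" "y \<in> verts D"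
      using scc[of x] scc[of y] by blast
    with R show "vertex_cut G x y S" unfolding vertex_cut_def using reach by blast
  qed
qed

text \<open>Supplies a cut for every nonadjacent pair, so that a constant coloring is an
  MVD-coloring.\<close>

lemma vertex_cut_Diff_endpoints:
  assumes G: "pair_graph G" and xy: "x \<in> pverts G" "y \<in> pverts G" "x \<noteq> y" "(x, y) \<notin> parcs G"
  shows "vertex_cut G x y (pverts G - {x, y})"
proof -
  interpret pair_graph G by fact
  let ?H = "with_proj G \<restriction> (pverts G - (pverts G - {x, y}))"
  have "\<not> x \<rightarrow>\<^sup>*\<^bsub>?H\<^esub> y"
  proof
    assume "x \<rightarrow>\<^sup>*\<^bsub>?H\<^esub> y"
    \<comment> \<open>The first arc of a walk from \<open>x\<close> could end only in
      \<open>x\<close>, a loop, or in \<open>y\<close>, a nonneighbour.\<close>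
    then obtain z where z: "x \<rightarrow>\<^bsub>?H\<^esub> z"
      using xy by (auto elim: pre_digraph.converse_reachable_cases)
    then have "z \<in> {x, y}" and "(x, z) \<in> parcs G"
      by (auto simp: arcs_ends_conv)
    then show False using xy no_loops' by auto
  qed
  with xy show ?thesis by (auto simp: vertex_cut_iff_not_reachable[OF G])
qed

text \<open>Otherwise the path from \<open>x\<close> through \<open>z\<close> to \<open>y\<close>
  survives the deletion of \<open>S\<close>.\<close>

lemma common_neighbour_in_vertex_cut:
  assumes G: "pair_graph G" and cut: "vertex_cut G x y S"
    and z: "(x, z) \<in> parcs G" "(z, y) \<in> parcs G"
  shows "z \<in> S"
proof (rule ccontr)
  assume "z \<notin> S"
  interpret pair_graph G by fact
  let ?H = "with_proj G \<restriction> (pverts G - S)"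
  interpret H: wf_digraph ?H by auto
  have S: "S \<subseteq> pverts G - {x, y}" and nreach: "\<not> x \<rightarrow>\<^sup>*\<^bsub>?H\<^esub> y"
    using cut by (simp_all add: vertex_cut_iff_not_reachable[OF G])
  have "x \<rightarrow>\<^bsub>?H\<^esub> z" "z \<rightarrow>\<^bsub>?H\<^esub> y"
    using z S \<open>z \<notin> S\<close> wellformed'[OF z(1)] wellformed'[OF z(2)]
    by (auto simp: arcs_ends_conv intro!: rev_image_eqI)
  then have "x \<rightarrow>\<^sup>*\<^bsub>?H\<^esub> y" by (meson H.reachable_adjI H.reachable_trans)
  with nreach show False ..
qed

lemma MVD_coloring_common_neighbours:
  assumes G: "pair_graph G" and c: "MVD_coloring G c"
    and xy: "x \<noteq> y" "(x, y) \<notin> parcs G"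
    and u: "(x, u) \<in> parcs G" "(u, y) \<in> parcs G"
    and v: "(x, v) \<in> parcs G" "(v, y) \<in> parcs G"
  shows "c u = c v"
proof -
  interpret pair_graph G by fact
  have "x \<in> pverts G" "y \<in> pverts G"
    using wellformed'[OF u(1)] wellformed'[OF u(2)] by auto
  then obtain S where "vertex_cut G x y S" "monochromatic c S"
    using c xy unfolding MVD_coloring_def by blast
  then show ?thesis
    using common_neighbour_in_vertex_cut[OF G] u v unfolding monochromatic_def by blast
qed

text \<open>The pair \<open>x\<close>, \<open>y\<close> may vary with \<open>v\<close> while
  \<open>h\<close> stays fixed, so every color is compared directly with \<open>c h\<close>.\<close>

lemma mvd_eq_1I:
  assumes G: "pair_graph G" and h: "h \<in> pverts G"
    and nbrs: "\<And>v. v \<in> pverts G \<Longrightarrow> v \<noteq> h \<Longrightarrow>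
      \<exists>x y. x \<noteq> y \<and> (x, y) \<notin> parcs G \<and>
        (x, v) \<in> parcs G \<and> (v, y) \<in> parcs G \<and> (x, h) \<in> parcs G \<and> (h, y) \<in> parcs G"
  shows "mvd G = 1"
proof -
  have "c v = c h" if "MVD_coloring G c" "v \<in> pverts G" for c v
    using nbrs[OF that(2)] MVD_coloring_common_neighbours[OF G that(1)] by metis
  then have "c ` pverts G = {c h}" if "MVD_coloring G c" for c
    using that h by blast
  then have one: "card (c ` pverts G) = 1" if "MVD_coloring G c" for c
    using that by simp
  \<comment> \<open>Some MVD-coloring must exist: \<open>Max\<close> of an empty set of color counts
    would be unspecified.\<close>
  have const: "MVD_coloring G (\<lambda>_. 0)"
    unfolding MVD_coloring_def monochromatic_def
    using vertex_cut_Diff_endpoints[OF G] by blast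
  have "{card (c ` pverts G) | c. MVD_coloring G c} = {1}"
  proof (rule subset_antisym)
    show "{card (c ` pverts G) | c. MVD_coloring G c} \<subseteq> {1}" using one by auto
    have "card ((\<lambda>_. 0 :: nat) ` pverts G) \<in> {card (c ` pverts G) | c. MVD_coloring G c}"
      using const by blast
    then show "{1} \<subseteq> {card (c ` pverts G) | c. MVD_coloring G c}"
      unfolding one[OF const] by simp
  qed
  then show ?thesis by (simp add: mvd_def)
qed

lemma mvd_wheel_graph:
  assumes "n \<ge> 5" and W: "wheel_graph n G"
  shows "mvd G = 1"
proof -
  define m where "m = n - 1"
  have m: "m \<ge> 4" using \<open>n \<ge> 5\<close> by (simp add: m_def)
  obtain C H where C: "cycle_graph m C" and H: "complete_digraph 1 (with_proj H)"
    and disj: "pverts C \<inter> pverts H = {}" and G: "G = graph_join C H"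
    using W unfolding wheel_graph_def m_def by blast
  obtain f where f: "bij_betw f {..<m} (pverts C)"
    and E: "parcs C = {(f i, f j) | i j. i < m \<and> j < m \<and> (j = Suc i mod m \<or> i = Suc j mod m)}"
    using C unfolding cycle_graph_def by blast
  from H obtain h where h: "pverts H = {h}"
    by (auto simp: complete_digraph_pair_def card_1_singleton_iff)
  have EH: "parcs H = {}"
    using H h by (auto simp: complete_digraph_pair_def)
  have fV: "f i \<in> pverts C" if "i < m" for i
    using f that by (auto simp: bij_betw_def)
  have f_eq: "f i = f j \<longleftrightarrow> i = j" if "i < m" "j < m" for i j
    using f that by (auto simp: bij_betw_def dest: inj_onD)
  show ?thesis
  proof (rule mvd_eq_1I[where h = h])
    show "pair_graph G" using W by (rule wheel_graph_pair_graph)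
    show "h \<in> pverts G" by (simp add: G graph_join_def h)
    fix v assume "v \<in> pverts G" "v \<noteq> h"
    then have "v \<in> pverts C" by (auto simp: G graph_join_def h)
    then obtain i where i: "i < m" "v = f i" using f by (auto simp: bij_betw_def)
    \<comment> \<open>\<open>a\<close> and \<open>b\<close> index the rim neighbours of
      \<open>v\<close>. The case \<open>i = 0\<close> wraps around by hand, since
      \<open>0 - 1\<close> is \<open>0\<close> on naturals.\<close>
    define a where "a = (if i = 0 then m - 1 else i - 1)"
    define b where "b = Suc i mod m"
    have ab: "a < m" "b < m" using m i by (auto simp: a_def b_def)
    have ia: "i = Suc a mod m" using m i by (auto simp: a_def)
    \<comment> \<open>The last inequality relies on \<open>m \<ge> 4\<close>: on a triangle the two
      neighbours of \<open>v\<close> are adjacent.\<close>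
    have ne: "a \<noteq> b" "b \<noteq> Suc a mod m" "a \<noteq> Suc b mod m"
      using m i by (auto simp: a_def b_def mod_Suc split: if_splits)
    have "(f a, f b) \<notin> parcs C" using ne ab by (auto simp: E f_eq)
    moreover have "h \<notin> pverts C" using disj h by auto
    ultimately have "(f a, f b) \<notin> parcs G"
      using fV[OF ab(1)] fV[OF ab(2)] by (auto simp: G graph_join_def h EH)
    moreover have "(f a, f i) \<in> parcs C" "(f i, f b) \<in> parcs C"
      unfolding E using i ab ia b_def by blast+
    then have "(f a, v) \<in> parcs G" "(v, f b) \<in> parcs G"
      by (simp_all add: G graph_join_def i)
    moreover have "(f a, h) \<in> parcs G" "(h, f b) \<in> parcs G"
      using fV ab by (auto simp: G graph_join_def h)
    moreover have "f a \<noteq> f b" using f_eq ab ne by simp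
    ultimately show "\<exists>x y. x \<noteq> y \<and> (x, y) \<notin> parcs G \<and>
        (x, v) \<in> parcs G \<and> (v, y) \<in> parcs G \<and> (x, h) \<in> parcs G \<and> (h, y) \<in> parcs G"
      by blast
  qed
qed

lemma mvd_complete_multipartite_graph:
  assumes k: "k > 2" and ns: "ns k \<ge> 2" "ns (k - 1) \<ge> 2"
    and M: "complete_multipartite_graph k ns G"
  shows "mvd G = 1"
proof -
  obtain P :: "nat \<Rightarrow> 'a set" where
    P: "\<forall>i\<in>{1..k}. finite (P i) \<and> card (P i) = ns i \<and> ns i \<ge> 1"
    and disj: "\<forall>i\<in>{1..k}. \<forall>j\<in>{1..k}. i \<noteq> j \<longrightarrow> P i \<inter> P j = {}"
    and V: "pverts G = (\<Union>i\<in>{1..k}. P i)"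
    and E: "parcs G = (\<Union>i\<in>{1..k}. \<Union>j\<in>{1..k} - {i}. P i \<times> P j)"
    using M unfolding complete_multipartite_graph_def by (elim exE conjE) (rule that; assumption)
  have adj: "(u, v) \<in> parcs G \<longleftrightarrow> i \<noteq> j"
    if "i \<in> {1..k}" "j \<in> {1..k}" "u \<in> P i" "v \<in> P j" for i j u v
  proof
    assume "(u, v) \<in> parcs G"
    then obtain i' j' where ij': "i' \<in> {1..k}" "j' \<in> {1..k}" "i' \<noteq> j'" "u \<in> P i'" "v \<in> P j'"
      unfolding E by blast
    \<comment> \<open>Disjointness makes the part containing a vertex unique.\<close>
    then have "i' = i" "j' = j" using that disj by (meson disjoint_iff)+
    with ij' show "i \<noteq> j" by simp
  next
    assume "i \<noteq> j"
    with that show "(u, v) \<in> parcs G" unfolding E by blast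
  qed
  have one: "1 \<in> {1..k}" using k by simp
  with P have "P 1 \<noteq> {}" by fastforce
  then obtain h where h: "h \<in> P 1" by blast
  show ?thesis
  proof (rule mvd_eq_1I[where h = h])
    show "pair_graph G" using M by (rule complete_multipartite_graph_pair_graph)
    show "h \<in> pverts G" using h k by (auto simp: V)
    fix v assume "v \<in> pverts G"
    then obtain i where i: "i \<in> {1..k}" "v \<in> P i" by (auto simp: V)
    \<comment> \<open>Part \<open>j\<close> must avoid both \<open>v\<close> and \<open>h\<close>.
      As \<open>k > 2\<close>, neither \<open>k - 1\<close> nor \<open>k\<close> is
      \<open>1\<close>, the index of the part of \<open>h\<close>.\<close>
    define j where "j = (if i = k then k - 1 else k)"
    have j: "j \<in> {1..k}" "j \<noteq> i" "j \<noteq> 1" "ns j \<ge> 2"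
      using k ns by (auto simp: j_def)
    have "card (P j) \<ge> 2" using P j by simp
    then obtain x y where xy: "x \<in> P j" "y \<in> P j" "x \<noteq> y"
      by (auto simp: card_le_Suc_iff numeral_2_eq_2)
    have "(x, y) \<notin> parcs G" "(x, v) \<in> parcs G" "(v, y) \<in> parcs G"
      "(x, h) \<in> parcs G" "(h, y) \<in> parcs G"
      using xy h i j one adj[of j j x y] adj[of j i x v] adj[of i j v y] adj[of j 1 x h] adj[of 1 j h y]
      by simp_all
    with xy show "\<exists>x y. x \<noteq> y \<and> (x, y) \<notin> parcs G \<and>
        (x, v) \<in> parcs G \<and> (v, y) \<in> parcs G \<and> (x, h) \<in> parcs G \<and> (h, y) \<in> parcs G"
      by blast
  qed
qed

theorem theorem3p1:
  fixes G :: "'a pair_pre_digraph"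
  assumes "(\<exists>n. n \<ge> 5 \<and> wheel_graph n G) \<or>
           (\<exists>k ns. k > 2 \<and> ns k \<ge> 2 \<and> ns (k - 1) \<ge> 2 \<and> complete_multipartite_graph k ns G)"
  shows "mvd G = 1"
  using assms mvd_wheel_graph mvd_complete_multipartite_graph by blast

end
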